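(* Let $(Y,\mathbf{X})$ be a $(d+1)$-dimensional random vector such that the distribution function $F_Y$ of $Y$ is continuous. The following statements are equivalent: (i) For $\mathbb{P}^{\mathbf{X}}$-almost every $\mathbf{x}\in\mathbb{R}^d$, the conditional distribution of $F_Y(Y)$ given $\mathbf{X}=\mathbf{x}$ has no atoms, i.e. $\mathbb{P}\bigl(F_Y(Y)=v\mid \mathbf{X}=\mathbf{x}\bigr)=0$ for every $v\in[0,1]$. (ii) $\phi_{(Y,\mathbf{X})}(0)=0$.
   Context: $Y$ is real-valued and $\mathbf{X}$ takes values in $\mathbb{R}^d$, $d\ge 1$; $\mathbb{P}^{\mathbf{X}}$ is the law of $\mathbf{X}$, and conditional distributions given $\mathbf{X}=\mathbf{x}$ are regular conditional distributions. $Y'$ is a random variable (on a possibly extended probability space) such that, conditionally on $\mathbf{X}$, $Y$ and $Y'$ are independent and identically distributed, i.e. $\mathbb{P}(Y\in A, Y'\in B\mid \mathbf{X})=\mathbb{P}(Y\in A\mid\mathbf{X})\,\mathbb{P}(Y\in B\mid\mathbf{X})$ almost surely for all Borel sets $A,B\subseteq\mathbb{R}$. For $t\in[0,1]$, $$\phi_{(Y,\mathbf{X})}(t):=\mathbb{P}\bigl(|F_Y(Y)-F_Y(Y')|\le t\bigr).$$ *)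

theory Defs
  imports "HOL-Probability.Probability"
begin

text \<open>A version of the conditional probability of the event \<open>{\<omega>. P \<omega>}\<close> given \<open>\<sigma>(X)\<close>.\<close>
definition cond_prob_given ::
    "'a measure \<Rightarrow> ('a \<Rightarrow> 'b::topological_space) \<Rightarrow> ('a \<Rightarrow> bool) \<Rightarrow> 'a \<Rightarrow> real" where
  "cond_prob_given M X P =
     real_cond_exp M (vimage_algebra (space M) X borel) (indicator {\<omega> \<in> space M. P \<omega>})"

text \<open>\<open>K x\<close> is the conditional distribution of \<open>Z\<close> given \<open>X = x\<close>. Such a kernel is unique
  only up to a null set of the law of \<open>X\<close>, hence a predicate rather than a function.\<close>
definition regular_cond_distr ::
    "'a measure \<Rightarrow> ('a \<Rightarrow> 'b::topological_space) \<Rightarrow> ('a \<Rightarrow> real) \<Rightarrow> ('b \<Rightarrow> real measure) \<Rightarrow> bool" where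
  "regular_cond_distr M X Z K \<longleftrightarrow>
     K \<in> borel \<rightarrow>\<^sub>M prob_algebra borel \<and>
     (\<forall>A\<in>sets borel. AE \<omega> in M. cond_prob_given M X (\<lambda>\<omega>. Z \<omega> \<in> A) \<omega> = measure (K (X \<omega>)) A)"

text \<open>On the right-hand side both factors involve \<open>Y\<close>; taking \<open>A = UNIV\<close> shows that \<open>Y'\<close> has
  the same conditional law as \<open>Y\<close>.\<close>
definition cond_iid ::
    "'a measure \<Rightarrow> ('a \<Rightarrow> 'b::topological_space) \<Rightarrow> ('a \<Rightarrow> real) \<Rightarrow> ('a \<Rightarrow> real) \<Rightarrow> bool" where
  "cond_iid M X Y Y' \<longleftrightarrow>
     (\<forall>A\<in>sets borel. \<forall>B\<in>sets borel. AE \<omega> in M.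
        cond_prob_given M X (\<lambda>\<omega>. Y \<omega> \<in> A \<and> Y' \<omega> \<in> B) \<omega> =
        cond_prob_given M X (\<lambda>\<omega>. Y \<omega> \<in> A) \<omega> * cond_prob_given M X (\<lambda>\<omega>. Y \<omega> \<in> B) \<omega>)"

definition distr_fun :: "'a measure \<Rightarrow> ('a \<Rightarrow> real) \<Rightarrow> real \<Rightarrow> real" where
  "distr_fun M Y = cdf (distr M borel Y)"

text \<open>\<open>Y'\<close> is a parameter, to be used with a copy satisfying \<open>cond_iid M X Y Y'\<close>. The dependence
  on \<open>X\<close> is only through \<open>Y'\<close>.\<close>
definition phi :: "'a measure \<Rightarrow> ('a \<Rightarrow> real) \<Rightarrow> ('a \<Rightarrow> real) \<Rightarrow> real \<Rightarrow> real" where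
  "phi M Y Y' t = \<P>(\<omega> in M. \<bar>distr_fun M Y (Y \<omega>) - distr_fun M Y (Y' \<omega>)\<bar> \<le> t)"

end

theory Submission
  imports Defs
begin

text \<open>
  Put \<open>Z = F(Y)\<close> and \<open>Z' = F(Y')\<close>, where \<open>F\<close> is the distribution function of \<open>Y\<close>; being monotone,
  \<open>F\<close> is Borel, so conditional independence and equality of conditional laws pass from \<open>Y, Y'\<close> to
  \<open>Z, Z'\<close>. The number \<open>\<phi>(0)\<close> is the probability that \<open>Z = Z'\<close>, that is, the mass that the law of
  \<open>(Z, Z')\<close> gives to the diagonal.

  Taking expectations in the conditional product formula shows that the law of \<open>(Z, Z')\<close> agrees on
  rectangles, hence everywhere, with the mixture over the law of \<open>X\<close> of the squares
  \<open>K x \<Otimes> K x\<close> of the conditional laws of \<open>Z\<close> (\<open>cond_iid_joint_law\<close>). Therefore \<open>\<phi>(0) = 0\<close>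
  exactly when, for almost every \<open>x\<close>, the diagonal is a null set of \<open>K x \<Otimes> K x\<close>. By Fubini the
  mass of the diagonal under \<open>Q \<Otimes> Q\<close> is \<open>\<integral> Q{v} dQ(v)\<close>, the sum of the squared masses of the atoms
  of \<open>Q\<close>, so it vanishes precisely when \<open>Q\<close> has no atoms (\<open>diagonal_null_iff_no_atoms\<close>). Atoms at
  points outside the unit interval cannot occur, because almost every \<open>K x\<close> is concentrated on
  \<open>{0..1}\<close>, where \<open>F\<close> takes its values (\<open>regular_cond_distr_concentrated\<close>).
\<close>

lemma sigma_finite_subalgebra_vimage_algebra:
  fixes X :: "'a \<Rightarrow> 'b::topological_space"
  assumes "prob_space M" and X: "X \<in> borel_measurable M"
  shows "sigma_finite_subalgebra M (vimage_algebra (space M) X borel)"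
proof -
  interpret prob_space M by fact
  have "sets (vimage_algebra (space M) X borel) \<subseteq> sets M"
    using X by (auto simp: sets_vimage_algebra2 dest: measurable_sets)
  then have "finite_measure_subalgebra M (vimage_algebra (space M) X borel)"
    by unfold_locales (auto simp: subalgebra_def)
  then show ?thesis
    by (rule finite_measure_subalgebra_is_sigma_finite)
qed

lemma integral_cond_prob_given:
  fixes X :: "'a \<Rightarrow> 'b::topological_space"
  assumes "prob_space M" "X \<in> borel_measurable M" and P: "{\<omega> \<in> space M. P \<omega>} \<in> sets M"
  shows "(\<integral>\<omega>. cond_prob_given M X P \<omega> \<partial>M) = measure M {\<omega> \<in> space M. P \<omega>}"
proof -
  interpret prob_space M by fact
  interpret sigma_finite_subalgebra M "vimage_algebra (space M) X borel"
    using assms by (intro sigma_finite_subalgebra_vimage_algebra)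
  have "integrable M (indicator {\<omega> \<in> space M. P \<omega>} :: 'a \<Rightarrow> real)"
    using P by (simp add: emeasure_eq_measure)
  from real_cond_exp_int(2)[OF this] show ?thesis
    using P by (simp add: cond_prob_given_def)
qed

text \<open>
  The event \<open>Z \<in> S\<close> is the whole space, so the constant \<open>1\<close> is a version of its conditional
  probability; \<open>K X S\<close> is another version, and versions agree almost surely.
\<close>
lemma regular_cond_distr_concentrated:
  fixes X :: "'a \<Rightarrow> 'b::topological_space"
  assumes "prob_space M" and X: "X \<in> borel_measurable M" and K: "regular_cond_distr M X Z K"
    and S: "S \<in> sets borel" and Z: "\<And>\<omega>. \<omega> \<in> space M \<Longrightarrow> Z \<omega> \<in> S"
  shows "AE x in distr M borel X. measure (K x) S = 1"
proof -
  interpret prob_space M by fact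
  interpret sigma_finite_subalgebra M "vimage_algebra (space M) X borel"
    using assms by (intro sigma_finite_subalgebra_vimage_algebra)
  have K_meas[measurable]: "K \<in> borel \<rightarrow>\<^sub>M subprob_algebra borel"
    using K unfolding regular_cond_distr_def by (intro measurable_prob_algebraD) auto
  have full: "{\<omega> \<in> space M. Z \<omega> \<in> S} = space M"
    using Z by auto
  have "AE \<omega> in M. cond_prob_given M X (\<lambda>\<omega>. Z \<omega> \<in> S) \<omega> = indicator (space M) \<omega>"
    unfolding cond_prob_given_def full
  proof (rule real_cond_exp_F_meas)
    show "integrable M (indicator (space M) :: 'a \<Rightarrow> real)"
      by (simp add: emeasure_eq_measure)
    show "(indicator (space M) :: 'a \<Rightarrow> real) \<in> borel_measurable (vimage_algebra (space M) X borel)"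
      using sets.top[of "vimage_algebra (space M) X borel"]
      by (intro borel_measurable_indicator) simp
  qed
  moreover have "AE \<omega> in M. cond_prob_given M X (\<lambda>\<omega>. Z \<omega> \<in> S) \<omega> = measure (K (X \<omega>)) S"
    using K S by (auto simp: regular_cond_distr_def)
  moreover have "AE \<omega> in M. \<omega> \<in> space M"
    by simp
  ultimately have "AE \<omega> in M. measure (K (X \<omega>)) S = 1"
    by eventually_elim auto
  moreover have "{x \<in> space borel. measure (K x) S = 1} \<in> sets borel"
    using S by measurable
  ultimately show ?thesis
    using X by (subst AE_distr_iff) auto
qed

lemma cond_iid_compose:
  fixes f :: "real \<Rightarrow> real"
  assumes iid: "cond_iid M X Y Y'" and f: "f \<in> borel_measurable borel"
  shows "cond_iid M X (\<lambda>\<omega>. f (Y \<omega>)) (\<lambda>\<omega>. f (Y' \<omega>))"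
  unfolding cond_iid_def
proof (intro ballI)
  fix A B :: "real set"
  assume "A \<in> sets borel" "B \<in> sets borel"
  then have "f -` A \<in> sets borel" "f -` B \<in> sets borel"
    using measurable_sets[OF f] by auto
  then have "AE \<omega> in M.
      cond_prob_given M X (\<lambda>\<omega>. Y \<omega> \<in> f -` A \<and> Y' \<omega> \<in> f -` B) \<omega> =
      cond_prob_given M X (\<lambda>\<omega>. Y \<omega> \<in> f -` A) \<omega> * cond_prob_given M X (\<lambda>\<omega>. Y \<omega> \<in> f -` B) \<omega>"
    using iid unfolding cond_iid_def by blast
  then show "AE \<omega> in M.
      cond_prob_given M X (\<lambda>\<omega>. f (Y \<omega>) \<in> A \<and> f (Y' \<omega>) \<in> B) \<omega> =
      cond_prob_given M X (\<lambda>\<omega>. f (Y \<omega>) \<in> A) \<omega> * cond_prob_given M X (\<lambda>\<omega>. f (Y \<omega>) \<in> B) \<omega>"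
    by (simp only: vimage_eq)
qed

text \<open>
  Rectangles form an intersection-stable generator, so only they need checking. On \<open>A \<times> B\<close> the left
  side is the expectation of a conditional probability, which the hypotheses turn into the
  expectation of \<open>K X A * K X B\<close>; this is the mixture of the product measures of the rectangle.
\<close>
lemma cond_iid_joint_law:
  fixes X :: "'a \<Rightarrow> 'b::topological_space"
  assumes M: "prob_space M" and X[measurable]: "X \<in> borel_measurable M"
    and Z[measurable]: "Z \<in> borel_measurable M" and Z'[measurable]: "Z' \<in> borel_measurable M"
    and iid: "cond_iid M X Z Z'" and K: "regular_cond_distr M X Z K"
  shows "distr M (borel \<Otimes>\<^sub>M borel) (\<lambda>\<omega>. (Z \<omega>, Z' \<omega>)) = distr M borel X \<bind> (\<lambda>x. K x \<Otimes>\<^sub>M K x)"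
    (is "?L = ?R")
proof -
  interpret prob_space M by fact
  have K_prob: "K \<in> borel \<rightarrow>\<^sub>M prob_algebra borel"
    using K by (simp add: regular_cond_distr_def)
  have K_meas[measurable]: "K \<in> borel \<rightarrow>\<^sub>M subprob_algebra borel"
    using K_prob by (rule measurable_prob_algebraD)
  have Kx: "prob_space (K x)" "sets (K x) = sets borel" for x
    using measurable_space[OF K_prob, of x] by (auto simp: space_prob_algebra)
  have KK: "(\<lambda>x. K x \<Otimes>\<^sub>M K x) \<in> distr M borel X \<rightarrow>\<^sub>M subprob_algebra (borel \<Otimes>\<^sub>M borel)"
    using measurable_pair_measure[OF K_meas K_meas] by simp
  have sets_R: "sets ?R = sets (borel \<Otimes>\<^sub>M borel)"
    using KK by (intro sets_bind) (auto dest: subprob_measurableD)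
  have rectangle: "emeasure ?L (A \<times> B) = emeasure ?R (A \<times> B)"
    if A: "A \<in> sets borel" and B: "B \<in> sets borel" for A B
  proof -
    have "AE \<omega> in M. cond_prob_given M X (\<lambda>\<omega>. Z \<omega> \<in> A \<and> Z' \<omega> \<in> B) \<omega>
        = cond_prob_given M X (\<lambda>\<omega>. Z \<omega> \<in> A) \<omega> * cond_prob_given M X (\<lambda>\<omega>. Z \<omega> \<in> B) \<omega>"
      using iid A B by (auto simp: cond_iid_def)
    moreover have "AE \<omega> in M. cond_prob_given M X (\<lambda>\<omega>. Z \<omega> \<in> A) \<omega> = measure (K (X \<omega>)) A"
      "AE \<omega> in M. cond_prob_given M X (\<lambda>\<omega>. Z \<omega> \<in> B) \<omega> = measure (K (X \<omega>)) B"
      using K A B by (auto simp: regular_cond_distr_def)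
    ultimately have cond: "AE \<omega> in M. cond_prob_given M X (\<lambda>\<omega>. Z \<omega> \<in> A \<and> Z' \<omega> \<in> B) \<omega>
        = measure (K (X \<omega>)) A * measure (K (X \<omega>)) B"
      by eventually_elim simp
    have meas: "(\<lambda>\<omega>. measure (K (X \<omega>)) A * measure (K (X \<omega>)) B) \<in> borel_measurable M"
      using A B by measurable
    have event: "{\<omega> \<in> space M. Z \<omega> \<in> A \<and> Z' \<omega> \<in> B} \<in> sets M"
      using A B by measurable
    have "emeasure ?L (A \<times> B) = emeasure M {\<omega> \<in> space M. Z \<omega> \<in> A \<and> Z' \<omega> \<in> B}"
      using A B by (subst emeasure_distr) (auto intro!: arg_cong[where f = "emeasure M"])
    also have "\<dots> = ennreal (\<integral>\<omega>. cond_prob_given M X (\<lambda>\<omega>. Z \<omega> \<in> A \<and> Z' \<omega> \<in> B) \<omega> \<partial>M)"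
      using integral_cond_prob_given[OF M X event] by (simp add: emeasure_eq_measure)
    also have "\<dots> = ennreal (\<integral>\<omega>. measure (K (X \<omega>)) A * measure (K (X \<omega>)) B \<partial>M)"
      using cond meas
      by (intro arg_cong[where f = ennreal] integral_cong_AE)
        (auto simp: cond_prob_given_def intro!: borel_measurable_cond_exp2)
    also have "\<dots> = (\<integral>\<^sup>+\<omega>. ennreal (measure (K (X \<omega>)) A * measure (K (X \<omega>)) B) \<partial>M)"
    proof (rule nn_integral_eq_integral[symmetric])
      show "integrable M (\<lambda>\<omega>. measure (K (X \<omega>)) A * measure (K (X \<omega>)) B)"
        using meas by (rule integrable_const_bound[where B = 1, rotated])
          (auto intro!: mult_le_one prob_space.prob_le_1[OF Kx(1)])
    qed simp
    also have "\<dots> = (\<integral>\<^sup>+\<omega>. emeasure (K (X \<omega>) \<Otimes>\<^sub>M K (X \<omega>)) (A \<times> B) \<partial>M)"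
    proof (rule nn_integral_cong)
      fix \<omega>
      interpret Q: prob_space "K (X \<omega>)" by (rule Kx)
      show "ennreal (measure (K (X \<omega>)) A * measure (K (X \<omega>)) B)
          = emeasure (K (X \<omega>) \<Otimes>\<^sub>M K (X \<omega>)) (A \<times> B)"
        using A B by (simp add: Q.emeasure_pair_measure_Times Kx Q.emeasure_eq_measure ennreal_mult)
    qed
    also have "\<dots> = (\<integral>\<^sup>+x. emeasure (K x \<Otimes>\<^sub>M K x) (A \<times> B) \<partial>distr M borel X)"
      using A B measurable_pair_measure[OF K_meas K_meas]
      by (subst nn_integral_distr) (auto intro!: measurable_emeasure_kernel)
    also have "\<dots> = emeasure ?R (A \<times> B)"
      using A B KK by (intro emeasure_bind[symmetric]) auto
    finally show ?thesis .
  qed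
  show ?thesis
  proof (rule measure_eqI_generator_eq[OF Int_stable_pair_measure_generator[of borel borel]])
    show "emeasure ?L C = emeasure ?R C"
      if "C \<in> {a \<times> b |a b. a \<in> sets borel \<and> b \<in> sets borel}" for C
      using that rectangle by auto
    show "sets ?L = sigma_sets UNIV {a \<times> b |a b. a \<in> sets borel \<and> b \<in> sets borel}"
      by (simp add: sets_pair_measure)
    show "sets ?R = sigma_sets UNIV {a \<times> b |a b. a \<in> sets borel \<and> b \<in> sets borel}"
      unfolding sets_R by (simp add: sets_pair_measure)
    show "range (\<lambda>_::nat. UNIV \<times> UNIV) \<subseteq> {a \<times> b |a b. a \<in> sets borel \<and> b \<in> sets (borel :: real measure)}"
      by force
    interpret L: prob_space ?L
      by (rule prob_space_distr) simp
    show "emeasure ?L (UNIV \<times> UNIV) \<noteq> \<infinity>"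
      by (simp add: L.emeasure_eq_measure)
  qed auto
qed

lemma sets_diagonal: "{p. fst p = snd p} \<in> sets (borel \<Otimes>\<^sub>M (borel :: real measure))"
proof -
  have "{p \<in> space (borel \<Otimes>\<^sub>M (borel :: real measure)). fst p = snd p} \<in> sets (borel \<Otimes>\<^sub>M borel)"
    by measurable
  then show ?thesis
    by (simp add: space_pair_measure)
qed

text \<open>
  The section of the diagonal at \<open>v\<close> is \<open>{v}\<close>, so the diagonal is null iff \<open>Q{v} = 0\<close> for
  \<open>Q\<close>-almost every \<open>v\<close>. An atom would lie in the exceptional null set, which has
  no room for a point of positive mass.
\<close>
lemma diagonal_null_iff_no_atoms:
  fixes Q :: "real measure"
  assumes "prob_space Q" and sets_Q[measurable_cong]: "sets Q = sets borel"
  shows "emeasure (Q \<Otimes>\<^sub>M Q) {p. fst p = snd p} = 0 \<longleftrightarrow> (\<forall>v. measure Q {v} = 0)"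
proof -
  interpret prob_space Q by fact
  interpret QQ: pair_sigma_finite Q Q ..
  have diag: "{p. fst p = snd p} \<in> sets (Q \<Otimes>\<^sub>M Q)"
    using sets_diagonal by (simp add: sets_Q cong: sets_pair_measure_cong)
  have meas: "(\<lambda>v. emeasure Q {v}) \<in> borel_measurable Q"
    using measurable_emeasure_Pair[OF diag] by (simp add: vimage_def)
  have "emeasure (Q \<Otimes>\<^sub>M Q) {p. fst p = snd p} = (\<integral>\<^sup>+v. emeasure Q {v} \<partial>Q)"
    using diag by (simp add: emeasure_pair_measure_alt vimage_def)
  then have "emeasure (Q \<Otimes>\<^sub>M Q) {p. fst p = snd p} = 0 \<longleftrightarrow> (\<integral>\<^sup>+v. emeasure Q {v} \<partial>Q) = 0"
    by simp
  also have "\<dots> \<longleftrightarrow> (AE v in Q. emeasure Q {v} = 0)"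
    using meas by (rule nn_integral_0_iff_AE)
  also have "\<dots> \<longleftrightarrow> (\<forall>v. measure Q {v} = 0)"
  proof
    assume ae: "AE v in Q. emeasure Q {v} = 0"
    show "\<forall>v. measure Q {v} = 0"
    proof (rule allI, rule ccontr)
      fix v assume atom: "measure Q {v} \<noteq> 0"
      from ae obtain N where N: "\<And>u. u \<in> space Q - N \<Longrightarrow> emeasure Q {u} = 0" "N \<in> null_sets Q"
        by (rule AE_E3) blast
      have "space Q = UNIV"
        using sets_eq_imp_space_eq[OF sets_Q] by simp
      with N(1)[of v] atom have "{v} \<subseteq> N"
        by (auto simp: emeasure_eq_measure)
      moreover have "{v} \<in> sets Q"
        by (simp add: sets_Q)
      ultimately have "{v} \<in> null_sets Q"
        using N(2) by (metis null_sets_subset)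
      with atom show False
        by (auto simp: null_sets_def emeasure_eq_measure)
    qed
  qed (simp add: emeasure_eq_measure)
  finally show ?thesis .
qed

theorem theorem2p2:
  fixes M :: "'a measure"
    and Y Y' :: "'a \<Rightarrow> real"
    and X :: "'a \<Rightarrow> real ^ 'd"
    and K :: "real ^ 'd \<Rightarrow> real measure"
  assumes "prob_space M"
    and "Y \<in> borel_measurable M"
    and "X \<in> borel_measurable M"
    and "Y' \<in> borel_measurable M"
    and "cond_iid M X Y Y'"
    and "continuous_on UNIV (distr_fun M Y)"
    and "regular_cond_distr M X (\<lambda>\<omega>. distr_fun M Y (Y \<omega>)) K"
  shows "(AE x in distr M borel X. \<forall>v\<in>{0..1}. measure (K x) {v} = 0) \<longleftrightarrow> phi M Y Y' 0 = 0"
proof -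
  interpret prob_space M by fact
  note [measurable] = assms(2-4)
  define F where "F = distr_fun M Y"
  define Z where "Z \<omega> = F (Y \<omega>)" for \<omega>
  define Z' where "Z' \<omega> = F (Y' \<omega>)" for \<omega>
  let ?D = "{p :: real \<times> real. fst p = snd p}"
  interpret law: real_distribution "distr M borel Y"
    by (rule real_distribution_distr) fact
  have F_meas[measurable]: "F \<in> borel_measurable borel"
    unfolding F_def distr_fun_def
    by (intro borel_measurable_mono monoI law.cdf_nondecreasing)
  have F_unit: "F y \<in> {0..1}" for y
    unfolding F_def distr_fun_def using law.cdf_nonneg law.cdf_bounded_prob by simp
  have Z_meas[measurable]: "Z \<in> borel_measurable M" "Z' \<in> borel_measurable M"
    unfolding Z_def Z'_def by measurable
  have K: "regular_cond_distr M X Z K"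
    using assms(7) unfolding Z_def F_def .
  have iid: "cond_iid M X Z Z'"
    unfolding Z_def Z'_def using assms(5) F_meas by (rule cond_iid_compose)
  have K_prob: "K \<in> borel \<rightarrow>\<^sub>M prob_algebra borel"
    using K by (simp add: regular_cond_distr_def)
  then have K_meas[measurable]: "K \<in> borel \<rightarrow>\<^sub>M subprob_algebra borel"
    by (rule measurable_prob_algebraD)
  have Kx: "prob_space (K x)" "sets (K x) = sets borel" for x
    using measurable_space[OF K_prob, of x] by (auto simp: space_prob_algebra)
  have KK: "(\<lambda>x. K x \<Otimes>\<^sub>M K x) \<in> distr M borel X \<rightarrow>\<^sub>M subprob_algebra (borel \<Otimes>\<^sub>M borel)"
    using measurable_pair_measure[OF K_meas K_meas] by simp

  have "phi M Y Y' 0 = measure M {\<omega> \<in> space M. Z \<omega> = Z' \<omega>}"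
    by (simp add: phi_def Z_def Z'_def F_def)
  then have "phi M Y Y' 0 = 0 \<longleftrightarrow> emeasure M {\<omega> \<in> space M. Z \<omega> = Z' \<omega>} = 0"
    by (simp add: emeasure_eq_measure)
  also have "emeasure M {\<omega> \<in> space M. Z \<omega> = Z' \<omega>}
      = emeasure (distr M (borel \<Otimes>\<^sub>M borel) (\<lambda>\<omega>. (Z \<omega>, Z' \<omega>))) ?D"
    using sets_diagonal by (subst emeasure_distr) (auto intro!: arg_cong[where f = "emeasure M"])
  also have "\<dots> = emeasure (distr M borel X \<bind> (\<lambda>x. K x \<Otimes>\<^sub>M K x)) ?D"
    using cond_iid_joint_law[OF assms(1,3) Z_meas iid K] by simp
  also have "\<dots> = (\<integral>\<^sup>+x. emeasure (K x \<Otimes>\<^sub>M K x) ?D \<partial>distr M borel X)"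
    using KK sets_diagonal by (intro emeasure_bind) auto
  also have "\<dots> = 0 \<longleftrightarrow> (AE x in distr M borel X. emeasure (K x \<Otimes>\<^sub>M K x) ?D = 0)"
    using measurable_emeasure_kernel[OF KK sets_diagonal] by (rule nn_integral_0_iff_AE)
  also have "\<dots> \<longleftrightarrow> (AE x in distr M borel X. \<forall>v. measure (K x) {v} = 0)"
    using diagonal_null_iff_no_atoms[OF Kx] by simp
  also have "\<dots> \<longleftrightarrow> (AE x in distr M borel X. \<forall>v\<in>{0..1}. measure (K x) {v} = 0)"
  proof (rule eventually_subst)
    have "AE x in distr M borel X. measure (K x) {0..1} = 1"
      using assms(1,3) K by (rule regular_cond_distr_concentrated)
        (simp_all only: Z_def F_unit borel_closed closed_atLeastAtMost)
    then show "AE x in distr M borel X.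
        (\<forall>v. measure (K x) {v} = 0) = (\<forall>v\<in>{0..1}. measure (K x) {v} = 0)"
    proof eventually_elim
      case (elim x)
      interpret Q: prob_space "K x" by (rule Kx)
      have "measure (K x) {v} = 0" if "v \<notin> {0..1}" for v
      proof -
        have "measure (K x) {0..1} + measure (K x) {v} = measure (K x) ({0..1} \<union> {v})"
          using that by (intro Q.finite_measure_Union[symmetric]) (auto simp: Kx)
        also have "\<dots> \<le> 1"
          by (rule Q.prob_le_1)
        finally show ?thesis
          using elim measure_nonneg[of "K x" "{v}"] by linarith
      qed
      then show ?case by blast
    qed
  qed
  finally show ?thesis by simp
qed

end
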